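(* Let $\Omega\subset\mathbb R^2$ be a parabolic NTA domain. Then either there are two functions $f,g:\mathbb R\to\mathbb R$ such that $\Omega=\{(x,t)\in\mathbb R^2\mid g(t)>x>f(t)\}$, or, after a possible reflection across the time axis (i.e. after possibly replacing $\Omega$ by its image under $(x,t)\mapsto(-x,t)$), there is a single function $f:\mathbb R\to\mathbb R$ such that $\Omega=\{(x,t)\in\mathbb R^2\mid x>f(t)\}$.
   Context: Points of $\mathbb R^2$ are written $(x,t)$, with $x$ the space and $t$ the time coordinate. The parabolic metric is $\|(x_1,t_1)-(x_2,t_2)\|=|x_1-x_2|+|t_1-t_2|^{1/2}$, and $\mathrm{dist}$ denotes distance in this metric, with the usual convention $\mathrm{dist}(\cdot,\emptyset)=+\infty$. For $r>0$, $C_r(x_0,t_0)=\{(x,t)\in\mathbb R^2 : |x-x_0|<r,\ |t-t_0|<r^2\}$. Parabolic NTA domain (in $\mathbb R^2$): a connected open set $\Omega\subset\mathbb R^2$ for which there are constants $\lambda\ge 2$ and $\gamma\ge\sqrt{2\lambda}+1$ such that: (1) (Interior forward and backward corkscrew condition) For every $(Q,\tau)\in\partial\Omega$ and $r>0$ there exist points $A_r^{\pm}(Q,\tau)=(X_r^\pm,t_r^\pm)\in\Omega\cap C_r(Q,\tau)$ with $\lambda^{-1}r^2\le\min(t_r^+-\tau,\ \tau-t_r^-)\le r^2$ and $\mathrm{dist}(A_r^\pm(Q,\tau),\partial\Omega)\ge r/\lambda$. (2) (Exterior forward and backward corkscrew condition) For every $(Q,\tau)\in\partial\Omega$ and $r>0$,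 the same holds with $\overline\Omega^{\,c}$ in place of $\Omega$, i.e. there exist points $(\tilde X_r^\pm,\tilde t_r^\pm)\in\overline\Omega^{\,c}\cap C_r(Q,\tau)$ with $\lambda^{-1}r^2\le\min(\tilde t_r^+-\tau,\ \tau-\tilde t_r^-)\le r^2$ and $\mathrm{dist}((\tilde X_r^\pm,\tilde t_r^\pm),\partial\Omega)\ge r/\lambda$. (3) (Harnack chain condition) There is a constant $c=c(\gamma)\ge1$ such that whenever $\varepsilon>0$ and $(X_1,t_1),(X_2,t_2)\in\Omega$ satisfy $t_2>t_1$, $(t_2-t_1)^{1/2}>\gamma^{-1}\|(X_1,t_1)-(X_2,t_2)\|$ and $\mathrm{dist}((X_i,t_i),\partial\Omega)>\varepsilon$ for $i=1,2$, there is a finite sequence of cylinders $\{C_{r_j}(Y_j,s_j)\}_{j=1}^{\ell}$ (a Harnack chain from $(X_1,t_1)$ to $(X_2,t_2)$) with (a) $(X_1,t_1)\in C_{r_1}(Y_1,s_1)$ and $(X_2,t_2)\in C_{r_\ell}(Y_\ell,s_\ell)$; (b) $C_{r_{j+1}}(Y_{j+1},s_{j+1})\cap C_{r_j}(Y_j,s_j)\ne\emptyset$ for $j=1,\dots,\ell-1$; (c) $c^{-1}\mathrm{dist}((Y_j,s_j),\partial\Omega)\le r_j\le c\,\mathrm{dist}((Y_j,s_j),\partial\Omega)$ for $j=1,\dots,\ell$; (d) $s_{j+1}-s_j\ge c^{-1}r_j^2$ for $j=1,\dots,\ell-1$; (e) $\ell\le c\log\bigl(2+\varepsilon^{-1}\|(X_1,t_1)-(X_2,t_2)\|\bigr)$.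 *)

theory Defs
  imports "HOL-Analysis.Analysis"
begin

text \<open>
  Points \<open>(x, t)\<close> of the plane are pairs of reals: space first, time second.
  The parabolic metric induces the usual product topology, so \<^const>\<open>open\<close>,
  \<^const>\<open>connected\<close>, \<^const>\<open>frontier\<close> and \<^const>\<open>closure\<close> are the library notions.
\<close>

definition pdist :: "real \<times> real \<Rightarrow> real \<times> real \<Rightarrow> real" where
  "pdist p q = \<bar>fst p - fst q\<bar> + sqrt \<bar>snd p - snd q\<bar>"

text \<open>
  Distance to a set is \<^typ>\<open>ereal\<close>-valued, so that the distance to the empty set is
  \<open>\<infinity>\<close>; the library's \<^const>\<open>infdist\<close> would give \<open>0\<close>.
\<close>

definition pdist_set :: "real \<times> real \<Rightarrow> (real \<times> real) set \<Rightarrow> ereal" where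
  "pdist_set p S = (INF q\<in>S. ereal (pdist p q))"

definition pcyl :: "real \<Rightarrow> real \<times> real \<Rightarrow> (real \<times> real) set" where
  "pcyl r p = {(x, t). \<bar>x - fst p\<bar> < r \<and> \<bar>t - snd p\<bar> < r\<^sup>2}"

text \<open>
  Forward and backward corkscrew points in \<open>U\<close> at every point of \<open>S\<close> and every scale.
  The interior condition is the case \<open>U = \<Omega>\<close>, the exterior condition the case
  \<open>U = - closure \<Omega>\<close>, both with \<open>S = frontier \<Omega>\<close>.
\<close>

definition corkscrew :: "real \<Rightarrow> (real \<times> real) set \<Rightarrow> (real \<times> real) set \<Rightarrow> bool" where
  "corkscrew l U S \<longleftrightarrow>
    (\<forall>Q \<tau> r. (Q, \<tau>) \<in> S \<and> r > 0 \<longrightarrow>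
      (\<exists>Xp tp Xm tm.
        (Xp, tp) \<in> U \<inter> pcyl r (Q, \<tau>) \<and> (Xm, tm) \<in> U \<inter> pcyl r (Q, \<tau>) \<and>
        r\<^sup>2 / l \<le> min (tp - \<tau>) (\<tau> - tm) \<and> min (tp - \<tau>) (\<tau> - tm) \<le> r\<^sup>2 \<and>
        pdist_set (Xp, tp) S \<ge> ereal (r / l) \<and> pdist_set (Xm, tm) S \<ge> ereal (r / l)))"

text \<open>
  The cylinders of the chain are \<open>pcyl (r j) (Y j, s j)\<close> for \<open>j = 1, \<dots>, n\<close>; values of
  \<open>r\<close>, \<open>Y\<close>, \<open>s\<close> at other indices are irrelevant.
\<close>

definition harnack_chain ::
  "real \<Rightarrow> real \<Rightarrow> (real \<times> real) set \<Rightarrow> real \<times> real \<Rightarrow> real \<times> real \<Rightarrow>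
    nat \<Rightarrow> (nat \<Rightarrow> real) \<Rightarrow> (nat \<Rightarrow> real) \<Rightarrow> (nat \<Rightarrow> real) \<Rightarrow> bool" where
  "harnack_chain c \<epsilon> S p q n r Y s \<longleftrightarrow>
    1 \<le> n \<and> (\<forall>j\<in>{1..n}. r j > 0) \<and>
    p \<in> pcyl (r 1) (Y 1, s 1) \<and> q \<in> pcyl (r n) (Y n, s n) \<and>
    (\<forall>j\<in>{1..<n}. pcyl (r (j + 1)) (Y (j + 1), s (j + 1)) \<inter> pcyl (r j) (Y j, s j) \<noteq> {}) \<and>
    (\<forall>j\<in>{1..n}. ereal (1 / c) * pdist_set (Y j, s j) S \<le> ereal (r j) \<and>
                 ereal (r j) \<le> ereal c * pdist_set (Y j, s j) S) \<and>
    (\<forall>j\<in>{1..<n}. s (j + 1) - s j \<ge> (r j)\<^sup>2 / c) \<and>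
    real n \<le> c * ln (2 + pdist p q / \<epsilon>)"

definition harnack_chain_condition :: "real \<Rightarrow> (real \<times> real) set \<Rightarrow> bool" where
  "harnack_chain_condition \<gamma> \<Omega> \<longleftrightarrow>
    (\<exists>c\<ge>1. \<forall>\<epsilon> X1 t1 X2 t2.
      \<epsilon> > 0 \<and> (X1, t1) \<in> \<Omega> \<and> (X2, t2) \<in> \<Omega> \<and> t2 > t1 \<and>
      sqrt (t2 - t1) > pdist (X1, t1) (X2, t2) / \<gamma> \<and>
      pdist_set (X1, t1) (frontier \<Omega>) > ereal \<epsilon> \<and>
      pdist_set (X2, t2) (frontier \<Omega>) > ereal \<epsilon> \<longrightarrow>
      (\<exists>n r Y s. harnack_chain c \<epsilon> (frontier \<Omega>) (X1, t1) (X2, t2) n r Y s))"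

definition parabolic_NTA :: "(real \<times> real) set \<Rightarrow> bool" where
  "parabolic_NTA \<Omega> \<longleftrightarrow>
    open \<Omega> \<and> connected \<Omega> \<and>
    (\<exists>l \<gamma>. l \<ge> 2 \<and> \<gamma> \<ge> sqrt (2 * l) + 1 \<and>
      corkscrew l \<Omega> (frontier \<Omega>) \<and>
      corkscrew l (- closure \<Omega>) (frontier \<Omega>) \<and>
      harnack_chain_condition \<gamma> \<Omega>)"

end

theory Submission imports Defs begin

text \<open>
  The exterior corkscrew condition controls the shape of the domain inside a horizontal line \<open>t =
  const\<close>, and both corkscrew conditions together control its behaviour as \<open>x \<rightarrow>
  \<plusminus>\<infinity>\<close>. The Harnack chain condition excludes the whole plane, because the radius
  of a cylinder in a chain is comparable to the distance from its centre to the boundary, which is infinite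
  if the boundary is empty.

  Time slices are intervals (lemma \<open>time_slice_is_interval\<close>). Suppose that a point outside the
  domain lies between two points of the domain on the line \<open>t = t0\<close>. As the domain is
  connected, it contains an arch: a path that stays on one side of the line, say in the future, and whose
  two ends lie on the line to the left and to the right of the gap (\<open>arch_over_gap\<close>). The part
  of the complement under the arch is compact, so it has a latest point. That is a boundary point with no
  exterior points just after it, which contradicts the exterior forward corkscrew condition
  (\<open>no_trapped_complement\<close>). Arches over the past are treated in the same way with the backward
  condition. That an arch really encloses the gap follows from Fashoda's theorem on crossing paths
  (\<open>arch_encloses\<close>).

  Next, fix a direction \<open>x \<rightarrow> \<infinity>\<close> or \<open>x \<rightarrow>
  -\<infinity>\<close> and let \<open>T\<close> be the set of times whose slice is unbounded in that
  direction; then \<open>T\<close> is empty or everything (\<open>far_times_trivial\<close>). Between a time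
  in \<open>T\<close> and a time outside \<open>T\<close> there is a boundary point on every vertical line
  far out. Corkscrew points of a fixed scale at these boundary points accumulate, in time, at some time
  \<open>t\<close>, and since each of them comes with a vertical segment of fixed length, all times near
  \<open>t\<close> have far points of the domain, or of the exterior (\<open>corkscrew_far_times\<close>).
  The interior condition thus shows that a nontrivial \<open>T\<close> contains an interval. At an end of a
  maximal interval of \<open>T\<close>, the exterior condition, taken at a scale slightly larger than that
  of the transition and directed back into the interval, produces a time in \<open>T\<close> with exterior
  points arbitrarily far out. But a slice that is an unbounded interval contains all far points.

  So the slices are bounded on the left at all times or at none, and likewise on the right. If they are
  never bounded on either side, the domain is the whole plane; the other three cases are the three
  alternatives of the theorem.
\<close>

section \<open>Corkscrew points with vertical segments\<close>

text \<open>
  The form in which the corkscrew conditions are used. The sign \<open>\<kappa>\<close> selects the future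
  or the past, so that every argument below covers both time directions at once. The distance bound is
  expressed by a vertical segment through the corkscrew point: for vertical displacements the parabolic
  distance is the square root of the elapsed time, whence the length \<open>(r / l)\<^sup>2\<close>.
\<close>

definition vertical_corkscrew :: "real \<Rightarrow> (real \<times> real) set \<Rightarrow> (real \<times> real) set \<Rightarrow> bool" where
  "vertical_corkscrew l U S \<longleftrightarrow>
    (\<forall>Q \<tau> r. \<forall>\<kappa>\<in>{1, - 1}. (Q, \<tau>) \<in> S \<and> 0 < r \<longrightarrow>
      (\<exists>X t. \<bar>X - Q\<bar> < r \<and> r\<^sup>2 / l \<le> \<kappa> * (t - \<tau>) \<and> \<kappa> * (t - \<tau>) < r\<^sup>2 \<and>
        (\<forall>s. \<bar>s - t\<bar> < (r / l)\<^sup>2 \<longrightarrow> (X, s) \<in> U)))"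

text \<open>
  A vertical segment that leaves \<open>U\<close> meets the boundary of \<open>U\<close>, and it would meet
  it at parabolic distance less than \<open>\<rho>\<close>.
\<close>

lemma vertical_segment_in_set:
  assumes "(X, t) \<in> U" "frontier U \<subseteq> S" "ereal \<rho> \<le> pdist_set (X, t) S" "0 < \<rho>"
    "\<bar>s - t\<bar> < \<rho>\<^sup>2"
  shows "(X, s) \<in> U"
proof (rule ccontr)
  assume "(X, s) \<notin> U"
  moreover have "connected ({X} \<times> closed_segment t s)"
    by (intro connected_Times) auto
  ultimately have "({X} \<times> closed_segment t s) \<inter> frontier U \<noteq> {}"
    using assms(1) by (intro connected_Int_frontier) auto
  then obtain u where u: "u \<in> closed_segment t s" "(X, u) \<in> S"
    using assms(2) by auto
  have "pdist_set (X, t) S \<le> ereal (pdist (X, t) (X, u))"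
    unfolding pdist_set_def using u(2) by (rule INF_lower)
  hence "\<rho> \<le> sqrt \<bar>t - u\<bar>"
    using assms(3) by (simp add: pdist_def) (metis ereal_less_eq(3) order_trans)
  hence "\<rho>\<^sup>2 \<le> \<bar>t - u\<bar>"
    using assms(4) by (metis abs_ge_zero less_imp_le power_mono real_sqrt_pow2)
  moreover have "\<bar>t - u\<bar> \<le> \<bar>s - t\<bar>"
    using u(1) by (auto simp: closed_segment_eq_real_ivl split: if_splits)
  ultimately show False using assms(5) by linarith
qed

lemma corkscrew_imp_vertical_corkscrew:
  assumes "corkscrew l U S" "frontier U \<subseteq> S" "0 < l"
  shows "vertical_corkscrew l U S"
  unfolding vertical_corkscrew_def
proof (intro allI ballI impI, elim conjE)
  fix Q \<tau> r \<kappa> :: real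
  assume \<kappa>: "\<kappa> \<in> {1, - 1}" and Q: "(Q, \<tau>) \<in> S" and r: "0 < r"
  obtain Xp tp Xm tm where
    p: "(Xp, tp) \<in> U" "(Xp, tp) \<in> pcyl r (Q, \<tau>)" "ereal (r / l) \<le> pdist_set (Xp, tp) S" and
    m: "(Xm, tm) \<in> U" "(Xm, tm) \<in> pcyl r (Q, \<tau>)" "ereal (r / l) \<le> pdist_set (Xm, tm) S" and
    time: "r\<^sup>2 / l \<le> min (tp - \<tau>) (\<tau> - tm)"
    using assms(1) Q r unfolding corkscrew_def by (metis IntE)
  note seg = vertical_segment_in_set[OF _ assms(2) _ divide_pos_pos[OF r assms(3)]]
  show "\<exists>X t. \<bar>X - Q\<bar> < r \<and> r\<^sup>2 / l \<le> \<kappa> * (t - \<tau>) \<and> \<kappa> * (t - \<tau>) < r\<^sup>2 \<and>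
        (\<forall>s. \<bar>s - t\<bar> < (r / l)\<^sup>2 \<longrightarrow> (X, s) \<in> U)"
  proof (cases "\<kappa> = 1")
    case True
    then show ?thesis
      using p time seg[OF p(1,3)] by (intro exI[of _ Xp] exI[of _ tp]) (auto simp: pcyl_def)
  next
    case False
    then show ?thesis
      using \<kappa> m time seg[OF m(1,3)] by (intro exI[of _ Xm] exI[of _ tm]) (auto simp: pcyl_def)
  qed
qed

section \<open>Time slices are intervals\<close>

text \<open>
  The part of the exterior corkscrew condition that concerns arbitrarily small scales, in the time direction
  \<open>\<kappa>\<close>; it determines the shape of the time slices.
\<close>

definition complement_accessible :: "real \<Rightarrow> (real \<times> real) set \<Rightarrow> bool" where
  "complement_accessible \<kappa> \<Omega> \<longleftrightarrow>
    (\<forall>Q \<tau> r. (Q, \<tau>) \<in> frontier \<Omega> \<and> 0 < r \<longrightarrow>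
      (\<exists>X t. \<bar>X - Q\<bar> < r \<and> 0 < \<kappa> * (t - \<tau>) \<and> \<kappa> * (t - \<tau>) < r\<^sup>2 \<and> (X, t) \<notin> \<Omega>))"

lemma exterior_corkscrew_imp_accessible:
  assumes "vertical_corkscrew l (- closure \<Omega>) (frontier \<Omega>)" "0 < l" "\<kappa> \<in> {1, - 1}"
  shows "complement_accessible \<kappa> \<Omega>"
  unfolding complement_accessible_def
proof (intro allI impI, elim conjE)
  fix Q \<tau> r :: real
  assume "(Q, \<tau>) \<in> frontier \<Omega>" and r: "0 < r"
  then obtain X t where X: "\<bar>X - Q\<bar> < r" "r\<^sup>2 / l \<le> \<kappa> * (t - \<tau>)" "\<kappa> * (t - \<tau>) < r\<^sup>2"
    "\<And>s. \<bar>s - t\<bar> < (r / l)\<^sup>2 \<Longrightarrow> (X, s) \<in> - closure \<Omega>"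
    using assms(1,3) unfolding vertical_corkscrew_def by meson
  have "0 < r\<^sup>2 / l" using r assms(2) by simp
  moreover have "(X, t) \<notin> \<Omega>"
    using X(4)[of t] r assms(2) closure_subset[of \<Omega>] by auto
  ultimately show "\<exists>X t. \<bar>X - Q\<bar> < r \<and> 0 < \<kappa> * (t - \<tau>) \<and> \<kappa> * (t - \<tau>) < r\<^sup>2 \<and> (X, t) \<notin> \<Omega>"
    using X(1-3) by (intro exI[of _ X] exI[of _ t]) linarith
qed

definition time_halfplane :: "real \<Rightarrow> real \<Rightarrow> (real \<times> real) set" where
  "time_halfplane \<kappa> t0 = {p. 0 \<le> \<kappa> * (snd p - t0)}"

lemma convex_time_halfplane: "convex (time_halfplane \<kappa> t0)"
proof -
  have "time_halfplane \<kappa> t0 = {p. inner (0, \<kappa>) p \<ge> \<kappa> * t0}"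
    by (auto simp: time_halfplane_def inner_prod_def algebra_simps)
  thus ?thesis by (simp add: convex_halfspace_ge)
qed

text \<open>
  If the complement of \<open>\<Omega>\<close> met \<open>D\<close> in the half plane, there would be a
  point of the complement that is extremal in the time direction \<open>\<kappa>\<close> among those in the
  closure of \<open>D\<close> and the half plane. It lies in the interior of \<open>D\<close>, because the
  relevant boundary of \<open>D\<close> is in \<open>\<Omega>\<close>, so everything near it and beyond it
  in time is in \<open>\<Omega>\<close>, against accessibility.
\<close>

lemma no_trapped_complement:
  assumes "open \<Omega>" and \<kappa>: "\<kappa> \<in> {1, - 1}"
    and ext: "complement_accessible \<kappa> \<Omega>"
    and D: "open D" "bounded D" "frontier D \<inter> time_halfplane \<kappa> t0 \<subseteq> \<Omega>"
  shows "D \<inter> time_halfplane \<kappa> t0 \<subseteq> \<Omega>"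
proof (rule ccontr)
  assume "\<not> ?thesis"
  then obtain p where p: "p \<in> D" "p \<in> time_halfplane \<kappa> t0" "p \<notin> \<Omega>" by blast
  define K where "K = closure D \<inter> time_halfplane \<kappa> t0 - \<Omega>"
  have "closed (time_halfplane \<kappa> t0)"
    unfolding time_halfplane_def by (intro closed_Collect_le continuous_intros)
  hence "compact K"
    unfolding K_def using D(2) \<open>open \<Omega>\<close>
    by (intro compact_diff compact_Int_closed) auto
  moreover have "p \<in> K" using p closure_subset by (auto simp: K_def)
  moreover have "continuous_on K (\<lambda>q. \<kappa> * snd q)" by (intro continuous_intros)
  ultimately obtain q where q: "q \<in> K" "\<And>q'. q' \<in> K \<Longrightarrow> \<kappa> * snd q' \<le> \<kappa> * snd q"
    using continuous_attains_sup[of K "\<lambda>q. \<kappa> * snd q"] by blast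
  obtain Q \<tau> where Q: "q = (Q, \<tau>)" by fastforce
  have "q \<in> D"
    using q(1) D(1,3) unfolding K_def frontier_def by (auto simp: interior_open)
  then obtain e where e: "0 < e" "ball q e \<subseteq> D" using D(1) open_contains_ball by blast
  have box: "(X, t) \<in> D" if "\<bar>X - Q\<bar> < e / 2" "\<bar>t - \<tau>\<bar> < e / 2" for X t
  proof -
    have "dist q (X, t) \<le> dist Q X + dist \<tau> t"
      unfolding Q dist_Pair_Pair by (rule sqrt_sum_squares_le_sum) auto
    also have "\<dots> < e" using that unfolding dist_real_def by linarith
    finally show ?thesis using e(2) by auto
  qed
  have above: "(X, t) \<in> \<Omega>" if "\<bar>X - Q\<bar> < e / 2" "\<bar>t - \<tau>\<bar> < e / 2" "0 < \<kappa> * (t - \<tau>)" for X t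
  proof (rule ccontr)
    assume "(X, t) \<notin> \<Omega>"
    moreover have "(X, t) \<in> closure D" using box[OF that(1,2)] closure_subset by blast
    moreover have "0 \<le> \<kappa> * (t - t0)"
      using q(1) that(3) by (simp add: K_def Q time_halfplane_def algebra_simps)
    ultimately have "(X, t) \<in> K" by (simp add: K_def time_halfplane_def)
    from q(2)[OF this] that(3) show False by (simp add: Q algebra_simps)
  qed
  have "q \<in> frontier \<Omega>"
  proof -
    have "q \<in> closure \<Omega>"
      unfolding closure_approachable
    proof (intro allI impI)
      fix d :: real assume d: "0 < d"
      \<comment> \<open>Points straight beyond \<open>q\<close> in time are in \<open>\<Omega>\<close> and converge to \<open>q\<close>.\<close>
      define h where "h = min d e / 4"
      have h: "0 < h" "h < e / 2" "h < d" using d e(1) by (auto simp: h_def)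
      have "(Q, \<tau> + \<kappa> * h) \<in> \<Omega>" using h \<kappa> by (intro above) auto
      moreover have "dist (Q, \<tau> + \<kappa> * h) q < d"
        using h \<kappa> by (auto simp: Q dist_Pair_Pair dist_real_def)
      ultimately show "\<exists>y\<in>\<Omega>. dist y q < d" by blast
    qed
    thus ?thesis using q(1) \<open>open \<Omega>\<close> by (simp add: K_def frontier_def interior_open)
  qed
  \<comment> \<open>The scale is at most \<open>1\<close>, so that \<open>r\<^sup>2 \<le> r\<close> and the cylinder stays within the box.\<close>
  define r where "r = min 1 (e / 2)"
  have r: "0 < r" "r \<le> e / 2" "r\<^sup>2 \<le> r"
    using e(1) by (auto simp: r_def power2_eq_square mult_le_cancel_left1 min_def)
  obtain X t where X: "\<bar>X - Q\<bar> < r" "0 < \<kappa> * (t - \<tau>)" "\<kappa> * (t - \<tau>) < r\<^sup>2" "(X, t) \<notin> \<Omega>"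
    using ext r(1) \<open>q \<in> frontier \<Omega>\<close> unfolding complement_accessible_def Q by meson
  have "\<bar>t - \<tau>\<bar> = \<kappa> * (t - \<tau>)" using X(2) \<kappa> by auto
  hence "(X, t) \<in> \<Omega>" using X r by (intro above) auto
  with X(4) show False by blast
qed

definition time_reflection :: "real \<Rightarrow> real \<times> real \<Rightarrow> real \<times> real" where
  "time_reflection t0 p = (fst p, 2 * t0 - snd p)"

text \<open>
  Folding the plane along the line \<open>t = t0\<close>, with values in the type for which Fashoda's
  theorem is stated.
\<close>

definition fold_at :: "real \<Rightarrow> real \<times> real \<Rightarrow> real ^ 2" where
  "fold_at t0 p = (\<chi> i. if i = 1 then fst p else \<bar>snd p - t0\<bar>)"

lemma fold_at_nth [simp]: "fold_at t0 p $ 1 = fst p" "fold_at t0 p $ 2 = \<bar>snd p - t0\<bar>"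
  by (simp_all add: fold_at_def)

lemma continuous_on_fold_at: "continuous_on A (fold_at t0)"
proof -
  have "continuous_on A (\<lambda>p. if i = 1 then fst p else \<bar>snd p - t0\<bar>)" for i :: 2
    by (cases "i = 1") (auto intro!: continuous_intros)
  thus ?thesis unfolding fold_at_def by (intro continuous_on_vec_lambda)
qed

lemma fold_at_eqD:
  assumes "fold_at t0 p = fold_at t0 q"
  shows "q = p \<or> q = time_reflection t0 p"
proof -
  have "fst p = fst q" "\<bar>snd p - t0\<bar> = \<bar>snd q - t0\<bar>"
    using assms by (metis fold_at_nth)+
  thus ?thesis by (auto simp: time_reflection_def prod_eq_iff)
qed

text \<open>
  The union of the arch and its mirror image plays the role of a closed curve, without the arch having to be
  simple. If \<open>(y, t0)\<close> were outside it, some path would lead from there to a point of the line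
  far to the right. Folding both this path and the arch into the upper half plane gives two paths whose
  endpoints interlace on the boundary line, so they meet by Fashoda's theorem; then the unfolded path meets
  the arch or its mirror image.
\<close>

lemma arch_encloses:
  fixes g :: "real \<Rightarrow> real \<times> real"
  assumes g: "path g" "pathstart g = (a, t0)" "pathfinish g = (b, t0)"
    and y: "a < y" "y < b" "(y, t0) \<notin> path_image g"
  shows "(y, t0) \<in> inside (path_image g \<union> time_reflection t0 ` path_image g)"
proof (rule ccontr)
  define S where "S = path_image g \<union> time_reflection t0 ` path_image g"
  assume "(y, t0) \<notin> inside (path_image g \<union> time_reflection t0 ` path_image g)"
  moreover have "(y, t0) \<notin> S"
  proof
    assume "(y, t0) \<in> S"
    then obtain p where "p \<in> path_image g" "(y, t0) = time_reflection t0 p"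
      using y(3) unfolding S_def by auto
    hence "p = (y, t0)" by (auto simp: time_reflection_def prod_eq_iff)
    thus False using \<open>p \<in> path_image g\<close> y(3) by simp
  qed
  ultimately have out: "(y, t0) \<in> outside S"
    unfolding S_def by (metis ComplI Un_iff inside_Un_outside)
  have "continuous_on (path_image g) (time_reflection t0)"
    unfolding time_reflection_def by (intro continuous_intros)
  hence S: "compact S"
    unfolding S_def using g(1) by (intro compact_Un compact_continuous_image compact_path_image) auto
  then obtain R where R: "S \<subseteq> ball 0 R"
    by (meson bounded_subset_ballD compact_imp_bounded)
  \<comment> \<open>A point of the line beyond both the bounded set \<open>S\<close> and the end \<open>b\<close> of the arch, for the interlacing.\<close>
  define c where "c = max \<bar>R\<bar> \<bar>b\<bar> + 1"
  have "norm (c, t0) \<ge> \<bar>c\<bar>" using norm_fst_le[of "c" t0] by (simp)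
  hence "(c, t0) \<in> - ball 0 R" by (auto simp: c_def)
  hence "(c, t0) \<in> outside S" using outside_subset_convex[OF convex_ball R] by blast
  moreover have "path_connected (outside S)"
    using S by (intro connected_open_path_connected open_outside connected_outside
        compact_imp_closed compact_imp_bounded) auto
  ultimately obtain k where k: "path k" "path_image k \<subseteq> outside S" "pathstart k = (y, t0)"
    "pathfinish k = (c, t0)"
    using out unfolding path_connected_def by blast
  let ?F = "fold_at t0 ` (path_image g \<union> path_image k)"
  have "compact ?F"
    using g(1) k(1) continuous_on_fold_at
    by (intro compact_continuous_image compact_Un compact_path_image) auto
  then obtain N where N: "?F \<subseteq> ball 0 N"
    by (meson bounded_subset_ballD compact_imp_bounded)
  define lo hi :: "real ^ 2" where "lo = vector [- N, 0]" and "hi = vector [N, N]"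
  have box: "?F \<subseteq> cbox lo hi"
  proof
    fix z assume z: "z \<in> ?F"
    hence "norm z \<le> N" using N by force
    hence "\<bar>z $ 1\<bar> \<le> N" "\<bar>z $ 2\<bar> \<le> N" using component_le_norm_cart[of z] order_trans by blast+
    moreover have "0 \<le> z $ 2" using z by auto
    ultimately show "z \<in> cbox lo hi" by (auto simp: mem_box_cart forall_2 lo_def hi_def)
  qed
  obtain z where "z \<in> path_image (fold_at t0 \<circ> g)" "z \<in> path_image (fold_at t0 \<circ> k)"
  proof (rule fashoda_interlace)
    show "path (fold_at t0 \<circ> g)" "path (fold_at t0 \<circ> k)"
      using g(1) k(1) continuous_on_fold_at by (auto intro: path_continuous_image)
    show "path_image (fold_at t0 \<circ> g) \<subseteq> cbox lo hi" "path_image (fold_at t0 \<circ> k) \<subseteq> cbox lo hi"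
      using box by (auto simp: path_image_compose)
  qed (use g k y in \<open>auto simp: pathstart_compose pathfinish_compose lo_def c_def\<close>)
  then obtain p q where pq: "p \<in> path_image g" "q \<in> path_image k" "fold_at t0 p = fold_at t0 q"
    by (auto simp: path_image_compose)
  hence "q \<in> S" using fold_at_eqD[OF pq(3)] unfolding S_def by auto
  moreover have "q \<in> outside S" using pq(2) k(2) by blast
  ultimately show False using outside_no_overlap[of S] by blast
qed

text \<open>
  The enclosed region is bounded by the arch and its mirror image; the latter touches the half plane of the
  arch only on the line, where it coincides with the arch. Hence the part of the boundary of the region that
  lies in this half plane is in \<open>\<Omega>\<close>, and no complement can be trapped there.
\<close>

lemma no_complement_under_arch:
  assumes "open \<Omega>" and \<kappa>: "\<kappa> \<in> {1, - 1}"
    and ext: "complement_accessible \<kappa> \<Omega>"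
    and arch: "path_component (\<Omega> \<inter> time_halfplane \<kappa> t0) (a, t0) (b, t0)"
    and y: "a < y" "y < b"
  shows "(y, t0) \<in> \<Omega>"
proof (rule ccontr)
  assume yn: "(y, t0) \<notin> \<Omega>"
  obtain g where g: "path g" "path_image g \<subseteq> \<Omega> \<inter> time_halfplane \<kappa> t0"
    "pathstart g = (a, t0)" "pathfinish g = (b, t0)"
    using arch unfolding path_component_def by blast
  define S where "S = path_image g \<union> time_reflection t0 ` path_image g"
  have "continuous_on (path_image g) (time_reflection t0)"
    unfolding time_reflection_def by (intro continuous_intros)
  hence S: "compact S"
    unfolding S_def using g(1) by (intro compact_Un compact_continuous_image compact_path_image) auto
  have "S \<inter> time_halfplane \<kappa> t0 \<subseteq> path_image g"
  proof
    fix p assume p: "p \<in> S \<inter> time_halfplane \<kappa> t0"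
    show "p \<in> path_image g"
    proof (cases "p \<in> path_image g")
      case False
      then obtain q where q: "q \<in> path_image g" "p = time_reflection t0 q"
        using p unfolding S_def by blast
      moreover have "q \<in> time_halfplane \<kappa> t0" using q(1) g(2) by blast
      ultimately have "snd q = t0"
        using p \<kappa> by (auto simp: time_halfplane_def time_reflection_def)
      hence "p = q" using q(2) by (simp add: time_reflection_def prod_eq_iff)
      thus ?thesis using q(1) by simp
    qed
  qed
  moreover have "frontier (inside S) \<subseteq> S"
    using S by (intro frontier_inside_subset compact_imp_closed)
  ultimately have fr: "frontier (inside S) \<inter> time_halfplane \<kappa> t0 \<subseteq> \<Omega>" using g(2) by blast
  have "inside S \<inter> time_halfplane \<kappa> t0 \<subseteq> \<Omega>"
    by (rule no_trapped_complement[OF assms(1) \<kappa> ext open_inside[OF compact_imp_closed[OF S]]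
          bounded_inside[OF compact_imp_bounded[OF S]] fr])
  moreover have "(y, t0) \<in> inside S"
    unfolding S_def using yn g by (intro arch_encloses[OF g(1,3,4) y]) auto
  moreover have "(y, t0) \<in> time_halfplane \<kappa> t0" by (simp add: time_halfplane_def)
  ultimately show False using yn by blast
qed

text \<open>
  Call a point of \<open>\<Omega>\<close> left if it can be joined to the line left of the gap by a path
  that stays in one of the two closed half planes. Without an arch, no point of the line right of the gap is
  left. Being left is then locally constant: the only way to change the half plane is through a point of the
  line, and such a point, if it is left, is itself to the left of the gap. As \<open>\<Omega>\<close> is
  connected, all its points would be left, including \<open>(x2, t0)\<close>.
\<close>

lemma arch_over_gap:
  assumes "open \<Omega>" "connected \<Omega>" "(x1, t0) \<in> \<Omega>" "(x2, t0) \<in> \<Omega>" "(y, t0) \<notin> \<Omega>"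
    "x1 < y" "y < x2"
  shows "\<exists>\<kappa>\<in>{1, - 1}. \<exists>a b. a < y \<and> y < b \<and>
    path_component (\<Omega> \<inter> time_halfplane \<kappa> t0) (a, t0) (b, t0)"
proof (rule ccontr)
  assume no_arch: "\<not> ?thesis"
  define P where "P p \<longleftrightarrow> (\<exists>\<kappa>\<in>{1, - 1}. \<exists>a<y. path_component (\<Omega> \<inter> time_halfplane \<kappa> t0) (a, t0) p)" for p
  have left: "P (x, t0)" if "(x, t0) \<in> \<Omega>" "x < y" for x
  proof -
    have "path_component (\<Omega> \<inter> time_halfplane 1 t0) (x, t0) (x, t0)"
      using that by (intro path_component_refl) (simp add: time_halfplane_def)
    thus ?thesis using that(2) unfolding P_def by blast
  qed
  have on_line: "x < y" if "P (x, t0)" "(x, t0) \<in> \<Omega>" for x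
  proof (rule ccontr)
    assume "\<not> x < y"
    hence "y < x" using that(2) assms(5) by (metis not_less_iff_gr_or_eq)
    thus False using no_arch that(1) unfolding P_def by blast
  qed
  have same_side: "P q"
    if B: "convex B" "B \<subseteq> \<Omega>" "p \<in> B" "q \<in> B" and \<kappa>: "\<kappa> \<in> {1, - 1}"
      and side: "p \<in> time_halfplane \<kappa> t0" "q \<in> time_halfplane \<kappa> t0" and "P p" for B p q \<kappa>
  proof -
    obtain \<kappa>' a where \<kappa>': "\<kappa>' \<in> {1, - 1}" "a < y"
      "path_component (\<Omega> \<inter> time_halfplane \<kappa>' t0) (a, t0) p"
      using \<open>P p\<close> unfolding P_def by blast
    \<comment> \<open>If the given path uses the other half plane, then \<open>p\<close> lies on the line, hence left of the gap, and a constant path serves.\<close>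
    obtain a' where a': "a' < y" "path_component (\<Omega> \<inter> time_halfplane \<kappa> t0) (a', t0) p"
    proof (cases "\<kappa>' = \<kappa>")
      case True
      then show ?thesis using that \<kappa>' by blast
    next
      case False
      have "p \<in> \<Omega> \<inter> time_halfplane \<kappa>' t0" using \<kappa>'(3) path_component_mem by blast
      hence "snd p = t0"
        using False side(1) \<kappa> \<kappa>'(1) by (auto simp: time_halfplane_def)
      hence p: "p = (fst p, t0)" by (simp add: prod_eq_iff)
      have pO: "p \<in> \<Omega>" using B by blast
      have "path_component (\<Omega> \<inter> time_halfplane \<kappa> t0) p p"
        using side(1) pO by (intro path_component_refl) simp
      moreover have "fst p < y" using on_line \<open>P p\<close> pO p by metis
      ultimately show ?thesis using that p by metis
    qed
    have "closed_segment p q \<subseteq> B \<inter> time_halfplane \<kappa> t0"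
      using B side by (intro closed_segment_subset convex_Int convex_time_halfplane) auto
    hence "path_component (\<Omega> \<inter> time_halfplane \<kappa> t0) p q"
      using B(2) by (intro path_component_linepath) auto
    hence "path_component (\<Omega> \<inter> time_halfplane \<kappa> t0) (a', t0) q"
      using a'(2) path_component_trans by blast
    thus ?thesis using a'(1) \<kappa> unfolding P_def by blast
  qed
  have convex_step: "P q" if B: "convex B" "B \<subseteq> \<Omega>" "p \<in> B" "q \<in> B" "P p" for B p q
  proof (cases "\<exists>\<kappa>\<in>{1, - 1}. p \<in> time_halfplane \<kappa> t0 \<and> q \<in> time_halfplane \<kappa> t0")
    case True
    then show ?thesis using same_side[OF B(1-4)] B(5) by blast
  next
    case False
    have "connected (snd ` closed_segment p q)"
      by (intro connected_continuous_image continuous_intros connected_segment)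
    moreover have "snd p \<in> snd ` closed_segment p q" "snd q \<in> snd ` closed_segment p q" by auto
    moreover have "snd p \<le> t0 \<and> t0 \<le> snd q \<or> snd q \<le> t0 \<and> t0 \<le> snd p"
      using False by (auto simp: time_halfplane_def)
    ultimately have "t0 \<in> snd ` closed_segment p q"
      unfolding connected_iff_interval by blast
    \<comment> \<open>The segment crosses the line at \<open>m\<close>, and each half of it stays on one side.\<close>
    then obtain m where m: "m \<in> closed_segment p q" "snd m = t0" by auto
    have mB: "m \<in> B" using m(1) B closed_segment_subset by blast
    have mH: "m \<in> time_halfplane \<kappa> t0" for \<kappa> using m(2) by (simp add: time_halfplane_def)
    have side: "\<exists>\<kappa>\<in>{1, - 1}. z \<in> time_halfplane \<kappa> t0" for z
      by (auto simp: time_halfplane_def)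
    have "P m" using same_side[OF B(1-3) mB] side[of p] mH B(5) by blast
    thus ?thesis using same_side[OF B(1,2) mB B(4)] side[of q] mH by blast
  qed
  have "P (x2, t0)"
    using assms(2,3,4) left[OF assms(3,6)]
  proof (rule connected_induction_simple)
    fix p assume "p \<in> \<Omega>"
    then obtain e where e: "0 < e" "ball p e \<subseteq> \<Omega>" using assms(1) open_contains_ball by blast
    have "openin (top_of_set \<Omega>) (ball p e)" using e(2) assms(1) by (simp add: openin_open_eq)
    moreover have "P z'" if "z \<in> ball p e" "z' \<in> ball p e" "P z" for z z'
      using convex_step[OF convex_ball e(2) that] .
    ultimately show "\<exists>T. openin (top_of_set \<Omega>) T \<and> p \<in> T \<and> (\<forall>x\<in>T. \<forall>y\<in>T. P x \<longrightarrow> P y)"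
      using e(1) centre_in_ball by blast
  qed
  from on_line[OF this assms(4)] assms(7) show False by simp
qed

lemma time_slice_is_interval:
  fixes \<Omega> :: "(real \<times> real) set"
  assumes "open \<Omega>" "connected \<Omega>"
    and ext: "\<And>\<kappa>. \<kappa> \<in> {1, - 1} \<Longrightarrow> complement_accessible \<kappa> \<Omega>"
  shows "is_interval {x. (x, t) \<in> \<Omega>}"
  unfolding is_interval_1
proof (intro ballI allI impI, unfold mem_Collect_eq)
  fix x1 x2 y assume x: "(x1, t) \<in> \<Omega>" "(x2, t) \<in> \<Omega>" "x1 \<le> y \<and> y \<le> x2"
  show "(y, t) \<in> \<Omega>"
  proof (rule ccontr)
    assume y: "(y, t) \<notin> \<Omega>"
    hence "x1 < y" "y < x2" using x by (metis order_le_less)+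
    from arch_over_gap[OF assms(1,2) x(1,2) y this] obtain \<kappa> a b where
      \<kappa>: "\<kappa> \<in> {1, - 1}" "a < y" "y < b" "path_component (\<Omega> \<inter> time_halfplane \<kappa> t) (a, t) (b, t)"
      by blast
    have "(y, t) \<in> \<Omega>"
      by (rule no_complement_under_arch[OF assms(1) \<kappa>(1) ext[OF \<kappa>(1)] \<kappa>(4,2,3)])
    with y show False by blast
  qed
qed

section \<open>Slices that are unbounded in space\<close>

definition far_times :: "real \<Rightarrow> (real \<times> real) set \<Rightarrow> real set" where
  "far_times \<sigma> U = {t. \<forall>M. \<exists>x. M < \<sigma> * x \<and> (x, t) \<in> U}"

text \<open>
  Compactness in time: corkscrew points of the same scale \<open>r\<close> at points of \<open>S\<close>
  further and further out have an accumulation point \<open>t\<close> of their times. A time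
  \<open>s\<close> near \<open>t\<close> is eventually within the vertical segments of these corkscrew
  points, so the slice at time \<open>s\<close> has points arbitrarily far out.
\<close>

lemma corkscrew_far_times:
  assumes cork: "vertical_corkscrew l U S" and \<sigma>: "\<sigma> \<in> {1, - 1}" and \<kappa>: "\<kappa> \<in> {1, - 1}"
    and l: "0 < l" and r: "0 < r"
    and far: "\<And>M. \<exists>x. \<exists>\<tau>\<in>{lo..hi}. M < \<sigma> * x \<and> (x, \<tau>) \<in> S"
  obtains \<tau> t where "\<tau> \<in> {lo..hi}" "r\<^sup>2 / l \<le> \<kappa> * (t - \<tau>)" "\<kappa> * (t - \<tau>) \<le> r\<^sup>2"
    "\<And>s. \<bar>s - t\<bar> < (r / l)\<^sup>2 \<Longrightarrow> s \<in> far_times \<sigma> U"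
proof -
  have "\<exists>X \<tau> t. real n - r < \<sigma> * X \<and> \<tau> \<in> {lo..hi} \<and> r\<^sup>2 / l \<le> \<kappa> * (t - \<tau>) \<and>
      \<kappa> * (t - \<tau>) \<le> r\<^sup>2 \<and> (\<forall>s. \<bar>s - t\<bar> < (r / l)\<^sup>2 \<longrightarrow> (X, s) \<in> U)" for n
  proof -
    obtain x \<tau> where x: "\<tau> \<in> {lo..hi}" "real n < \<sigma> * x" "(x, \<tau>) \<in> S"
      using far[of "real n"] by blast
    obtain X t where X: "\<bar>X - x\<bar> < r" "r\<^sup>2 / l \<le> \<kappa> * (t - \<tau>)" "\<kappa> * (t - \<tau>) < r\<^sup>2"
      "\<forall>s. \<bar>s - t\<bar> < (r / l)\<^sup>2 \<longrightarrow> (X, s) \<in> U"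
      using cork \<kappa> r x(3) unfolding vertical_corkscrew_def by meson
    have "real n - r < \<sigma> * X" using X(1) x(2) \<sigma> by auto
    with x X show ?thesis by (meson less_imp_le)
  qed
  then obtain X \<tau> t where seq: "\<And>n. real n - r < \<sigma> * X n" "\<And>n. \<tau> n \<in> {lo..hi}"
    "\<And>n. r\<^sup>2 / l \<le> \<kappa> * (t n - \<tau> n)" "\<And>n. \<kappa> * (t n - \<tau> n) \<le> r\<^sup>2"
    "\<And>n s. \<bar>s - t n\<bar> < (r / l)\<^sup>2 \<Longrightarrow> (X n, s) \<in> U"
    by metis
  have "compact ({lo..hi} \<times> {lo - r\<^sup>2..hi + r\<^sup>2})"
    by (intro compact_Times) auto
  moreover have "(\<tau> n, t n) \<in> {lo..hi} \<times> {lo - r\<^sup>2..hi + r\<^sup>2}" for n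
  proof -
    have "0 \<le> r\<^sup>2 / l" using l by simp
    thus ?thesis using seq(2-4)[of n] \<kappa> by auto
  qed
  ultimately obtain v \<phi> where v: "v \<in> {lo..hi} \<times> {lo - r\<^sup>2..hi + r\<^sup>2}" "strict_mono \<phi>"
    "((\<lambda>n. (\<tau> n, t n)) \<circ> \<phi>) \<longlonglongrightarrow> v"
    using seq_compactE[OF compact_imp_seq_compact, of _ "\<lambda>n. (\<tau> n, t n)"] by blast
  obtain \<tau>' t' where v': "v = (\<tau>', t')" by fastforce
  have \<tau>': "(\<lambda>n. \<tau> (\<phi> n)) \<longlonglongrightarrow> \<tau>'" and t': "(\<lambda>n. t (\<phi> n)) \<longlonglongrightarrow> t'"
    using tendsto_fst[OF v(3)] tendsto_snd[OF v(3)] by (simp_all add: v' comp_def)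
  have diff: "(\<lambda>n. \<kappa> * (t (\<phi> n) - \<tau> (\<phi> n))) \<longlonglongrightarrow> \<kappa> * (t' - \<tau>')"
    by (intro tendsto_intros t' \<tau>')
  show thesis
  proof
    show "\<tau>' \<in> {lo..hi}" using v(1) v' by simp
    show "r\<^sup>2 / l \<le> \<kappa> * (t' - \<tau>')"
      using diff seq(3) by (intro LIMSEQ_le_const) auto
    show "\<kappa> * (t' - \<tau>') \<le> r\<^sup>2"
      using diff seq(4) by (intro LIMSEQ_le_const2) auto
    fix s assume s: "\<bar>s - t'\<bar> < (r / l)\<^sup>2"
    have "(\<lambda>n. \<bar>s - t (\<phi> n)\<bar>) \<longlonglongrightarrow> \<bar>s - t'\<bar>"
      by (intro tendsto_intros t')
    hence ev: "\<forall>\<^sub>F n in sequentially. \<bar>s - t (\<phi> n)\<bar> < (r / l)\<^sup>2"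
      using s by (rule order_tendstoD)
    show "s \<in> far_times \<sigma> U"
      unfolding far_times_def
    proof safe
      fix M
      obtain N where N: "M + r < real N" using reals_Archimedean2 by blast
      obtain n where n: "N \<le> n" "\<bar>s - t (\<phi> n)\<bar> < (r / l)\<^sup>2"
        using ev unfolding eventually_sequentially by (metis nle_le order_trans)
      have "real N \<le> real (\<phi> n)"
        using n(1) seq_suble[OF v(2), of n] by simp
      hence "M < \<sigma> * X (\<phi> n)" using N seq(1)[of "\<phi> n"] by linarith
      thus "\<exists>x. M < \<sigma> * x \<and> (x, s) \<in> U" using seq(5)[OF n(2)] by blast
    qed
  qed
qed

lemma far_times_ray:
  assumes "\<sigma> \<in> {1, - 1}" and conv: "\<And>t. is_interval {x. (x, t) \<in> \<Omega>}"
    and "t \<in> far_times \<sigma> \<Omega>"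
  obtains a where "\<And>x. a < \<sigma> * x \<Longrightarrow> (x, t) \<in> \<Omega>"
proof -
  obtain x0 where x0: "(x0, t) \<in> \<Omega>" using assms(3) by (auto simp: far_times_def)
  show thesis
  proof
    fix x assume x: "\<sigma> * x0 < \<sigma> * x"
    obtain x1 where "\<sigma> * x < \<sigma> * x1" "(x1, t) \<in> \<Omega>"
      using assms(3) by (auto simp: far_times_def)
    then show "(x, t) \<in> \<Omega>"
      using x x0 assms(1) mem_is_interval_1_I[OF conv[of t], of x0 x1 x]
        mem_is_interval_1_I[OF conv[of t], of x1 x0 x] by auto
  qed
qed

text \<open>
  Far enough out, the vertical segment from time \<open>t1\<close> to time \<open>t2\<close> starts in
  \<open>\<Omega>\<close> and ends outside.
\<close>

lemma far_frontier:
  assumes \<sigma>: "\<sigma> \<in> {1, - 1}" and conv: "\<And>t. is_interval {x. (x, t) \<in> \<Omega>}"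
    and "t1 \<in> far_times \<sigma> \<Omega>" "t2 \<notin> far_times \<sigma> \<Omega>"
  shows "\<exists>x. \<exists>\<tau>\<in>{min t1 t2..max t1 t2}. M < \<sigma> * x \<and> (x, \<tau>) \<in> frontier \<Omega>"
proof -
  obtain a where a: "\<And>x. a < \<sigma> * x \<Longrightarrow> (x, t1) \<in> \<Omega>"
    using far_times_ray[OF \<sigma> conv assms(3)] by blast
  obtain b where b: "\<And>x. b < \<sigma> * x \<Longrightarrow> (x, t2) \<notin> \<Omega>"
    using assms(4) by (auto simp: far_times_def)
  \<comment> \<open>Multiplication by \<open>\<sigma>\<close> makes \<open>\<sigma> * x\<close> exceed \<open>M\<close>, \<open>a\<close> and \<open>b\<close>.\<close>
  define x where "x = \<sigma> * (max M (max a b) + 1)"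
  have x: "M < \<sigma> * x" "a < \<sigma> * x" "b < \<sigma> * x"
    using \<sigma> by (auto simp: x_def)
  have "connected ({x} \<times> {min t1 t2..max t1 t2})"
    by (intro connected_Times) auto
  hence "({x} \<times> {min t1 t2..max t1 t2}) \<inter> frontier \<Omega> \<noteq> {}"
  proof (rule connected_Int_frontier)
    show "({x} \<times> {min t1 t2..max t1 t2}) \<inter> \<Omega> \<noteq> {}"
      using a[OF x(2)] by (intro ex_in_conv[THEN iffD1] exI[of _ "(x, t1)"]) simp
    show "({x} \<times> {min t1 t2..max t1 t2}) - \<Omega> \<noteq> {}"
      using b[OF x(3)] by (intro ex_in_conv[THEN iffD1] exI[of _ "(x, t2)"]) simp
  qed
  thus ?thesis using x(1) by auto
qed

text \<open>
  Starting from a time \<open>t0\<close> in the interior of the set \<open>T\<close> of far times, move in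
  the direction \<open>\<kappa>\<close> of a time outside \<open>T\<close>; this leaves \<open>T\<close> for
  the first time after the duration \<open>Sup B\<close>. Just before and just after there are times in
  \<open>T\<close> and not in \<open>T\<close> whose difference is less than \<open>2 * \<epsilon>\<close>.
  Exterior corkscrew points in the direction \<open>- \<kappa>\<close> at the scale \<open>r\<close> with
  \<open>r\<^sup>2 / l = 2 * \<epsilon>\<close> overshoot this transition and, for small
  \<open>\<epsilon>\<close>, stay beyond \<open>t0\<close>, hence lie at times in \<open>T\<close>.
\<close>

lemma far_times_trivial:
  assumes \<sigma>: "\<sigma> \<in> {1, - 1}" and conv: "\<And>t. is_interval {x. (x, t) \<in> \<Omega>}" and l: "0 < l"
    and int: "vertical_corkscrew l \<Omega> (frontier \<Omega>)"
    and ext: "vertical_corkscrew l (- closure \<Omega>) (frontier \<Omega>)"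
  shows "far_times \<sigma> \<Omega> = {} \<or> far_times \<sigma> \<Omega> = UNIV"
proof (rule ccontr)
  assume "\<not> ?thesis"
  then obtain t1 t2 where t12: "t1 \<in> far_times \<sigma> \<Omega>" "t2 \<notin> far_times \<sigma> \<Omega>" by blast
  obtain t0 where t0: "\<And>s. \<bar>s - t0\<bar> < (1 / l)\<^sup>2 \<Longrightarrow> s \<in> far_times \<sigma> \<Omega>"
    using corkscrew_far_times[OF int \<sigma> _ l _ far_frontier[OF \<sigma> conv t12], of 1 1] by auto
  define \<delta> where "\<delta> = (1 / l)\<^sup>2"
  have \<delta>: "0 < \<delta>" using l by (simp add: \<delta>_def)
  define \<kappa> :: real where "\<kappa> = (if t2 > t0 then 1 else - 1)"
  have \<kappa>: "\<kappa> \<in> {1, - 1}" by (auto simp: \<kappa>_def)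
  have t2: "t2 = t0 + \<kappa> * \<bar>t2 - t0\<bar>" by (auto simp: \<kappa>_def)
  define B where "B = {h. 0 \<le> h \<and> (\<forall>h'\<in>{0..h}. t0 + \<kappa> * h' \<in> far_times \<sigma> \<Omega>)}"
  have bdd: "bdd_above B"
  proof (rule bdd_aboveI)
    fix h assume "h \<in> B"
    hence "\<bar>t2 - t0\<bar> \<notin> {0..h}" using t12(2) t2 unfolding B_def by (metis (lifting) mem_Collect_eq)
    thus "h \<le> \<bar>t2 - t0\<bar>" by simp
  qed
  have "t0 + \<kappa> * h \<in> far_times \<sigma> \<Omega>" if "h \<in> {0..\<delta> / 2}" for h
    using that \<delta> \<kappa> by (intro t0) (auto simp: \<delta>_def[symmetric])
  hence "\<delta> / 2 \<in> B" using \<delta> by (simp add: B_def)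
  hence h0: "\<delta> / 2 \<le> Sup B" using bdd by (rule cSup_upper)
  have below: "t0 + \<kappa> * h \<in> far_times \<sigma> \<Omega>" if h: "0 \<le> h" "h < Sup B" for h
  proof -
    obtain h' where "h' \<in> B" "h < h'"
      using less_cSupD[of B h] h(2) \<open>\<delta> / 2 \<in> B\<close> by blast
    thus ?thesis using h(1) by (auto simp: B_def)
  qed
  \<comment> \<open>Small enough for \<open>\<epsilon> + 2 * l * \<epsilon> < Sup B\<close>, where \<open>2 * l * \<epsilon> = r\<^sup>2\<close> bounds how far back the exterior points lie.\<close>
  define \<epsilon> where "\<epsilon> = \<delta> / (4 * (1 + 2 * l))"
  have \<epsilon>: "0 < \<epsilon>" "\<epsilon> * (1 + 2 * l) < \<delta> / 2" "\<epsilon> < \<delta> / 2"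
  proof -
    show "0 < \<epsilon>" using \<delta> l by (simp add: \<epsilon>_def)
    have "\<epsilon> * (1 + 2 * l) = \<delta> / 4" using l by (simp add: \<epsilon>_def field_simps)
    thus *: "\<epsilon> * (1 + 2 * l) < \<delta> / 2" using \<delta> by simp
    have "\<epsilon> * 1 \<le> \<epsilon> * (1 + 2 * l)" using \<open>0 < \<epsilon>\<close> l by (intro mult_left_mono) auto
    thus "\<epsilon> < \<delta> / 2" using * by simp
  qed
  obtain h2 where h2: "Sup B \<le> h2" "h2 < Sup B + \<epsilon>" "t0 + \<kappa> * h2 \<notin> far_times \<sigma> \<Omega>"
  proof -
    have "Sup B + \<epsilon> / 2 \<notin> B" using cSup_upper[OF _ bdd] \<epsilon>(1) by fastforce
    moreover have "0 \<le> Sup B + \<epsilon> / 2" using h0 \<delta> \<epsilon>(1) by linarith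
    ultimately obtain h where "0 \<le> h" "h \<le> Sup B + \<epsilon> / 2" "t0 + \<kappa> * h \<notin> far_times \<sigma> \<Omega>"
      by (auto simp: B_def)
    thus thesis using that[of h] below[of h] \<epsilon>(1) by force
  qed
  define s1 where "s1 = t0 + \<kappa> * (Sup B - \<epsilon>)"
  define s2 where "s2 = t0 + \<kappa> * h2"
  have s1: "s1 \<in> far_times \<sigma> \<Omega>"
    unfolding s1_def using h0 \<epsilon> by (intro below) auto
  define r where "r = sqrt (2 * l * \<epsilon>)"
  have r: "0 < r" "r\<^sup>2 = 2 * l * \<epsilon>" using l \<epsilon>(1) by (simp_all add: r_def)
  have "- \<kappa> \<in> {1, - 1}" using \<kappa> by auto
  then obtain \<tau> t where t: "\<tau> \<in> {min s1 s2..max s1 s2}" "r\<^sup>2 / l \<le> - \<kappa> * (t - \<tau>)"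
    "- \<kappa> * (t - \<tau>) \<le> r\<^sup>2" "\<And>s. \<bar>s - t\<bar> < (r / l)\<^sup>2 \<Longrightarrow> s \<in> far_times \<sigma> (- closure \<Omega>)"
    using corkscrew_far_times[OF ext \<sigma> _ l r(1) far_frontier[OF \<sigma> conv s1 h2(3), folded s2_def]]
    by metis
  have "t \<in> far_times \<sigma> (- closure \<Omega>)" using t(4)[of t] r(1) l by simp
  have "t \<in> far_times \<sigma> \<Omega>"
  proof -
    have "Sup B - \<epsilon> \<le> \<kappa> * (\<tau> - t0)" "\<kappa> * (\<tau> - t0) < Sup B + \<epsilon>"
      using t(1) \<kappa> h2(1,2) \<epsilon>(1) unfolding s1_def s2_def
      by (auto simp: min_def max_def split: if_splits)
    moreover have "2 * \<epsilon> \<le> \<kappa> * (\<tau> - t)" "\<kappa> * (\<tau> - t) \<le> 2 * l * \<epsilon>"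
      using t(2,3) l r(2) by (auto simp: algebra_simps)
    moreover have "\<kappa> * (t - t0) = \<kappa> * (\<tau> - t0) - \<kappa> * (\<tau> - t)" by (simp add: algebra_simps)
    moreover have "\<epsilon> * (1 + 2 * l) = \<epsilon> + 2 * l * \<epsilon>" by (simp add: algebra_simps)
    ultimately have "0 \<le> \<kappa> * (t - t0)" "\<kappa> * (t - t0) < Sup B"
      using h0 \<epsilon> by linarith+
    moreover have "t = t0 + \<kappa> * (\<kappa> * (t - t0))"
      using \<kappa> by auto
    ultimately show ?thesis using below by metis
  qed
  then obtain a where a: "\<And>x. a < \<sigma> * x \<Longrightarrow> (x, t) \<in> \<Omega>"
    using far_times_ray[OF \<sigma> conv, of t] by blast
  obtain x where "a < \<sigma> * x" "(x, t) \<in> - closure \<Omega>"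
    using \<open>t \<in> far_times \<sigma> (- closure \<Omega>)\<close> by (auto simp: far_times_def)
  thus False using a[of x] closure_subset[of \<Omega>] by auto
qed

section \<open>The graph representation\<close>

text \<open>
  A chain consists of at least one cylinder, and without a boundary its radius would be infinite.
\<close>

lemma harnack_chain_condition_imp_not_UNIV:
  assumes "harnack_chain_condition \<gamma> \<Omega>" "1 < \<gamma>"
  shows "\<Omega> \<noteq> UNIV"
proof
  assume U: "\<Omega> = UNIV"
  have inf: "pdist_set p {} = \<infinity>" for p
    by (simp add: pdist_set_def top_ereal_def)
  obtain c where c: "1 \<le> c" and chain: "\<And>\<epsilon> X1 t1 X2 t2.
      \<epsilon> > 0 \<and> (X1, t1) \<in> \<Omega> \<and> (X2, t2) \<in> \<Omega> \<and> t2 > t1 \<and>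
      sqrt (t2 - t1) > pdist (X1, t1) (X2, t2) / \<gamma> \<and>
      pdist_set (X1, t1) (frontier \<Omega>) > ereal \<epsilon> \<and>
      pdist_set (X2, t2) (frontier \<Omega>) > ereal \<epsilon> \<Longrightarrow>
      \<exists>n r Y s. harnack_chain c \<epsilon> (frontier \<Omega>) (X1, t1) (X2, t2) n r Y s"
    using assms(1) unfolding harnack_chain_condition_def by blast
  have "\<exists>n r Y s. harnack_chain c 1 (frontier \<Omega>) (0, 0) (0, 1) n r Y s"
    using assms(2) by (intro chain) (simp add: U inf pdist_def)
  then obtain n r Y s where "harnack_chain c 1 (frontier \<Omega>) (0, 0) (0, 1) n r Y s" by blast
  hence "ereal (1 / c) * pdist_set (Y 1, s 1) (frontier \<Omega>) \<le> ereal (r 1)"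
    unfolding harnack_chain_def by (meson atLeastAtMost_iff order_refl)
  thus False using c by (simp add: U inf)
qed

lemma open_interval_mem_iff:
  fixes S :: "real set"
  assumes "open S" "is_interval S"
  shows "x \<in> S \<longleftrightarrow> (\<exists>y\<in>S. y < x) \<and> (\<exists>z\<in>S. x < z)"
proof
  assume "x \<in> S"
  then obtain e where e: "0 < e" "cball x e \<subseteq> S" using assms(1) open_contains_cball by blast
  have "x - e \<in> cball x e" "x + e \<in> cball x e" using e(1) by (auto simp: dist_real_def)
  thus "(\<exists>y\<in>S. y < x) \<and> (\<exists>z\<in>S. x < z)"
    using e by (intro conjI bexI[of _ "x - e"] bexI[of _ "x + e"]) auto
next
  assume "(\<exists>y\<in>S. y < x) \<and> (\<exists>z\<in>S. x < z)"
  then obtain y z where "y \<in> S" "y < x" "z \<in> S" "x < z" by blast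
  thus "x \<in> S" using mem_is_interval_1_I[OF assms(2), of y z x] by simp
qed

theorem theorem2p2:
  fixes \<Omega> :: "(real \<times> real) set"
  assumes "parabolic_NTA \<Omega>"
  shows "(\<exists>f g :: real \<Rightarrow> real. \<Omega> = {(x, t). g t > x \<and> x > f t}) \<or>
         (\<exists>f :: real \<Rightarrow> real. \<Omega> = {(x, t). x > f t} \<or>
            (\<lambda>(x, t). (- x, t)) ` \<Omega> = {(x, t). x > f t})"
proof -
  obtain l \<gamma> where \<Omega>: "open \<Omega>" "connected \<Omega>" and l: "2 \<le> l" and \<gamma>: "sqrt (2 * l) + 1 \<le> \<gamma>"
    and int: "corkscrew l \<Omega> (frontier \<Omega>)" and ext: "corkscrew l (- closure \<Omega>) (frontier \<Omega>)"
    and harnack: "harnack_chain_condition \<gamma> \<Omega>"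
    using assms unfolding parabolic_NTA_def by blast
  have "0 < l" using l by simp
  have int': "vertical_corkscrew l \<Omega> (frontier \<Omega>)"
    using int \<open>0 < l\<close> by (intro corkscrew_imp_vertical_corkscrew) auto
  have "frontier (- closure \<Omega>) \<subseteq> frontier \<Omega>"
    using interior_mono[OF closure_subset, of \<Omega>] unfolding frontier_complement
    by (auto simp: frontier_def)
  hence ext': "vertical_corkscrew l (- closure \<Omega>) (frontier \<Omega>)"
    using ext \<open>0 < l\<close> by (intro corkscrew_imp_vertical_corkscrew)
  define S where "S t = {x. (x, t) \<in> \<Omega>}" for t
  have interval: "is_interval {x. (x, t) \<in> \<Omega>}" for t
    using exterior_corkscrew_imp_accessible[OF ext' \<open>0 < l\<close>]
    by (rule time_slice_is_interval[OF \<Omega>])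
  have "open (S t)" for t
  proof -
    have "S t = (\<lambda>x. (x, t)) -` \<Omega>" by (auto simp: S_def)
    thus ?thesis using \<Omega>(1) by (auto intro!: open_vimage continuous_intros)
  qed
  hence slice: "(x, t) \<in> \<Omega> \<longleftrightarrow> (\<exists>y\<in>S t. y < x) \<and> (\<exists>z\<in>S t. x < z)" for x t
    using open_interval_mem_iff[of "S t" x] interval[of t] by (simp add: S_def)
  have left_end: "(\<exists>y\<in>S t. y < x) \<longleftrightarrow> Inf (S t) < x"
    if "far_times (- 1) \<Omega> = {}" "S t \<noteq> {}" for x t
  proof -
    have "t \<notin> far_times (- 1) \<Omega>" using that(1) by simp
    then obtain M where M: "\<And>x. (x, t) \<in> \<Omega> \<Longrightarrow> \<not> M < - 1 * x"
      unfolding far_times_def by blast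
    have "- M \<le> x" if "x \<in> S t" for x using M[of x] that by (simp add: S_def)
    hence "bdd_below (S t)" by (rule bdd_belowI)
    thus ?thesis using that(2) by (simp add: cInf_less_iff)
  qed
  have right_end: "(\<exists>z\<in>S t. x < z) \<longleftrightarrow> x < Sup (S t)"
    if "far_times 1 \<Omega> = {}" "S t \<noteq> {}" for x t
  proof -
    have "t \<notin> far_times 1 \<Omega>" using that(1) by simp
    then obtain M where M: "\<And>x. (x, t) \<in> \<Omega> \<Longrightarrow> \<not> M < 1 * x"
      unfolding far_times_def by blast
    have "x \<le> M" if "x \<in> S t" for x using M[of x] that by (simp add: S_def)
    hence "bdd_above (S t)" by (rule bdd_aboveI)
    thus ?thesis using that(2) by (simp add: less_cSup_iff)
  qed
  have left_inf: "\<exists>y\<in>S t. y < x" if "far_times (- 1) \<Omega> = UNIV" for x t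
  proof -
    have "t \<in> far_times (- 1) \<Omega>" using that by simp
    then obtain y where "- x < - 1 * y" "(y, t) \<in> \<Omega>" unfolding far_times_def by blast
    thus ?thesis by (auto simp: S_def)
  qed
  have right_inf: "\<exists>z\<in>S t. x < z" if "far_times 1 \<Omega> = UNIV" for x t
  proof -
    have "t \<in> far_times 1 \<Omega>" using that by simp
    then obtain z where "x < 1 * z" "(z, t) \<in> \<Omega>" unfolding far_times_def by blast
    thus ?thesis by (auto simp: S_def)
  qed
  note trivial = far_times_trivial[OF _ interval \<open>0 < l\<close> int' ext']
  have "far_times (- 1) \<Omega> = {} \<or> far_times (- 1) \<Omega> = UNIV" by (rule trivial) simp
  moreover have "far_times 1 \<Omega> = {} \<or> far_times 1 \<Omega> = UNIV" by (rule trivial) simp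
  ultimately consider
      "far_times (- 1) \<Omega> = {}" "far_times 1 \<Omega> = {}"
    | "far_times (- 1) \<Omega> = {}" "far_times 1 \<Omega> = UNIV"
    | "far_times (- 1) \<Omega> = UNIV" "far_times 1 \<Omega> = {}"
    | "far_times (- 1) \<Omega> = UNIV" "far_times 1 \<Omega> = UNIV"
    by blast
  thus ?thesis
  proof cases
    case 1
    \<comment> \<open>An empty slice is represented by coinciding ends.\<close>
    define f g where "f t = (if S t = {} then 0 else Inf (S t))"
      and "g t = (if S t = {} then 0 else Sup (S t))" for t
    have "(x, t) \<in> \<Omega> \<longleftrightarrow> x < g t \<and> f t < x" for x t
    proof (cases "S t = {}")
      case True
      thus ?thesis by (auto simp: slice f_def g_def)
    next
      case False
      thus ?thesis using slice[of x t] left_end[OF 1(1) False] right_end[OF 1(2) False]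
        by (auto simp: f_def g_def)
    qed
    hence "\<Omega> = {(x, t). g t > x \<and> x > f t}" by auto
    thus ?thesis by blast
  next
    case 2
    have "(x, t) \<in> \<Omega> \<longleftrightarrow> Inf (S t) < x" for x t
      using slice[of x t] left_end[OF 2(1), of t x] right_inf[OF 2(2), of t x] by auto
    hence "\<Omega> = {(x, t). x > Inf (S t)}" by auto
    thus ?thesis by (intro disjI2 exI[of _ "\<lambda>t. Inf (S t)"] disjI1)
  next
    case 3
    have mem: "(x, t) \<in> \<Omega> \<longleftrightarrow> x < Sup (S t)" for x t
      using slice[of x t] left_inf[OF 3(1), of t x] right_end[OF 3(2), of t x] by auto
    have "(x, t) \<in> (\<lambda>(x, t). (- x, t)) ` \<Omega> \<longleftrightarrow> (- x, t) \<in> \<Omega>" for x t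
      by (force simp: image_iff)
    hence "(\<lambda>(x, t). (- x, t)) ` \<Omega> = {(x, t). x > - Sup (S t)}"
      by (auto simp: mem set_eq_iff minus_less_iff simp del: image_iff)
    thus ?thesis by (intro disjI2 exI[of _ "\<lambda>t. - Sup (S t)"])
  next
    case 4
    have "(x, t) \<in> \<Omega>" for x t
      using slice left_inf[OF 4(1)] right_inf[OF 4(2)] by blast
    hence "\<Omega> = UNIV" by auto
    moreover have "0 < sqrt (2 * l)" using l by simp
    ultimately show ?thesis
      using harnack_chain_condition_imp_not_UNIV[OF harnack] \<gamma> by linarith
  qed
qed

end
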